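(* Let $\mathcal{H}$ be a non-trivial complex Hilbert space, let $A\in\mathcal{B}(\mathcal{H})$ be a positive operator, let $T_{11}, T_{12}, T_{21},T_{22} \in \mathcal{B}_A(\mathcal{H})$, and let $B=\begin{pmatrix} A&O\\ O&A\end{pmatrix}$ on $\mathcal{H}\oplus\mathcal{H}$. Then for every real $t$ with $0\leq t\leq 1$, $$w_B\begin{pmatrix} T_{11}&T_{12} \\ T_{21}& T_{22}\end{pmatrix} \leq \frac{1}{2}w_A(T_{11})+w_A(T_{22}) +\frac{1}{2}\sqrt{t^2w^2_A(T_{11})+\|T_{12}\|_A^2} +\frac{1}{2}\sqrt{(1-t)^2w^2_A(T_{11})+\|T_{21}\|_A^2}.$$
   Context: $\mathcal{B}(\mathcal{H})$ is the algebra of bounded linear operators on the complex Hilbert space $(\mathcal{H},\langle\cdot,\cdot\rangle)$; $O$ is the zero operator. $A\in\mathcal{B}(\mathcal{H})$ is positive if $\langle Ax,x\rangle\ge 0$ for all $x\in\mathcal{H}$. Put $\langle x,y\rangle_A=\langle Ax,y\rangle$ and $\|x\|_A=\sqrt{\langle x,x\rangle_A}$ (a semi-norm). $\mathcal{B}_A(\mathcal{H})$ is the set of $T\in\mathcal{B}(\mathcal{H})$ that admit an $A$-adjoint, i.e. some $R\in\mathcal{B}(\mathcal{H})$ with $AR=T^*A$; equivalently $\mathcal{R}(T^*A)\subseteq\mathcal{R}(A)$, where $\mathcal{R}$ denotes range. For such operators, $\|T\|_A=\sup\{\|Tx\|_A/\|x\|_A : x\in\overline{\mathcal{R}(A)},\,x\ne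 0\}$ (finite), $w_A(T)=\sup\{|\langle Tx,x\rangle_A|: x\in\mathcal{H},\|x\|_A=1\}$ ($A$-numerical radius), and $w_A^2(T)=(w_A(T))^2$. The $B$-numerical radius $w_B$ is defined in the same way with $(\mathcal{H},A)$ replaced by $(\mathcal{H}\oplus\mathcal{H},B)$; $B$ is positive on $\mathcal{H}\oplus\mathcal{H}$. *)

theory Defs
  imports "HOL-Analysis.Analysis"
begin

section \<open>Complex Hilbert spaces\<close>

class complex_vector = real_vector +
  fixes scaleC :: "complex \<Rightarrow> 'a \<Rightarrow> 'a"  (infixr \<open>*\<^sub>C\<close> 75)
  assumes scaleC_add_right: "c *\<^sub>C (x + y) = c *\<^sub>C x + c *\<^sub>C y"
    and scaleC_add_left: "(c + d) *\<^sub>C x = c *\<^sub>C x + d *\<^sub>C x"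
    and scaleC_scaleC: "c *\<^sub>C (d *\<^sub>C x) = (c * d) *\<^sub>C x"
    and scaleR_scaleC: "r *\<^sub>R x = complex_of_real r *\<^sub>C x"

text \<open>The inner product is linear in its first argument.  The last axiom makes the real inner
  product of \<^class>\<open>real_inner\<close> the real part of the complex one; so the norm is induced by
  the complex inner product, which is therefore positive definite.\<close>

class complex_inner = complex_vector + real_inner +
  fixes cinner :: "'a \<Rightarrow> 'a \<Rightarrow> complex"
  assumes cinner_commute: "cinner x y = cnj (cinner y x)"
    and cinner_add_left: "cinner (x + y) z = cinner x z + cinner y z"
    and cinner_scaleC_left: "cinner (c *\<^sub>C x) y = c * cinner x y"
    and Re_cinner: "Re (cinner x y) = inner x y"

class chilbert_space = complex_inner + complete_space

lemma cinner_self: "cinner x x = complex_of_real ((norm x)\<^sup>2)"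
proof (rule complex_eqI)
  show "Re (cinner x x) = Re (complex_of_real ((norm x)\<^sup>2))"
    by (simp add: Re_cinner power2_norm_eq_inner)
  have "Im (cinner x x) = - Im (cinner x x)"
    using arg_cong[OF cinner_commute[of x x], of Im] by simp
  then show "Im (cinner x x) = Im (complex_of_real ((norm x)\<^sup>2))" by simp
qed

lemma cinner_add_right: "cinner x (y + z) = cinner x y + cinner x z"
  by (metis cinner_add_left cinner_commute complex_cnj_add)

lemma cinner_scaleC_right: "cinner x (c *\<^sub>C y) = cnj c * cinner x y"
  by (metis cinner_commute cinner_scaleC_left complex_cnj_mult)

lemma Im_cinner: "Im (cinner x y) = - inner (\<i> *\<^sub>C x) y"
  by (simp add: Re_cinner[symmetric] cinner_scaleC_left)

text \<open>The Hilbert space direct sum is the product type: its library norm and real inner product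
  are already those of the orthogonal sum.\<close>

instantiation prod :: (complex_vector, complex_vector) complex_vector
begin

definition scaleC_prod :: "complex \<Rightarrow> 'a \<times> 'b \<Rightarrow> 'a \<times> 'b"
  where "scaleC_prod c z = (c *\<^sub>C fst z, c *\<^sub>C snd z)"

instance
  by standard
    (simp_all add: scaleC_prod_def prod_eq_iff scaleC_add_right scaleC_add_left scaleC_scaleC
      scaleR_scaleC)

end

instantiation prod :: (complex_inner, complex_inner) complex_inner
begin

definition cinner_prod :: "'a \<times> 'b \<Rightarrow> 'a \<times> 'b \<Rightarrow> complex"
  where "cinner_prod z w = cinner (fst z) (fst w) + cinner (snd z) (snd w)"

instance
proof
  fix x y z :: "'a \<times> 'b" and c :: complex
  show "cinner x y = cnj (cinner y x)"
    by (simp add: cinner_prod_def cinner_commute[of "fst x"] cinner_commute[of "snd x"])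
  show "cinner (x + y) z = cinner x z + cinner y z"
    by (simp add: cinner_prod_def cinner_add_left)
  show "cinner (c *\<^sub>C x) y = c * cinner x y"
    by (simp add: cinner_prod_def scaleC_prod_def cinner_scaleC_left distrib_left)
  show "Re (cinner x y) = inner x y"
    by (simp add: cinner_prod_def Re_cinner inner_prod_def)
qed

end

instance prod :: (chilbert_space, chilbert_space) chilbert_space ..


section \<open>Bounded operators and adjoints\<close>

definition bounded_clinear :: "('a::complex_inner \<Rightarrow> 'b::complex_inner) \<Rightarrow> bool"
  where "bounded_clinear T \<longleftrightarrow> bounded_linear T \<and> (\<forall>c x. T (c *\<^sub>C x) = c *\<^sub>C T x)"

definition cadjoint :: "('a::complex_inner \<Rightarrow> 'a) \<Rightarrow> 'a \<Rightarrow> 'a"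
  where "cadjoint T = (THE S. \<forall>x y. cinner (T x) y = cinner x (S y))"

lemma real_riesz_representation:
  fixes f :: "'a::{real_inner, complete_space} \<Rightarrow> real"
  assumes f: "bounded_linear f"
  shows "\<exists>z. \<forall>x. f x = inner x z"
proof -
  interpret f: bounded_linear f by (rule f)
  define J where "J x = (norm x)\<^sup>2 / 2 - f x" for x
  obtain K where K: "\<And>x. norm (f x) \<le> norm x * K" using f.bounded by blast
  have Jlow: "- (K\<^sup>2 / 2) \<le> J x" for x
  proof -
    have "f x \<le> norm x * K" using K[of x] by simp
    moreover have "0 \<le> (norm x - K)\<^sup>2" by simp
    ultimately show ?thesis by (simp add: J_def power2_eq_square algebra_simps)
  qed
  define m where "m = Inf (range J)"
  have bdd: "bdd_below (range J)" by (rule bdd_belowI2) (rule Jlow)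
  have mle: "m \<le> J x" for x unfolding m_def by (rule cInf_lower) (auto intro: bdd)
  have par: "(norm (x - y))\<^sup>2 \<le> 4 * (J x + J y - 2 * m)" for x y
  proof -
    have "J ((1/2) *\<^sub>R (x + y)) = (J x + J y) / 2 - (norm (x - y))\<^sup>2 / 8"
      by (simp add: J_def f.add f.scaleR power2_norm_eq_inner inner_add inner_diff
          inner_commute field_simps)
    with mle[of "(1/2) *\<^sub>R (x + y)"] show ?thesis by (simp add: field_simps)
  qed
  have "\<exists>x. J x < m + 1 / real (Suc n)" for n
  proof -
    have "Inf (range J) < m + 1 / real (Suc n)" by (simp add: m_def)
    then show ?thesis using cInf_lessD[of "range J"] by blast
  qed
  then obtain X where X: "\<And>n. J (X n) < m + 1 / real (Suc n)" by metis
  have "Cauchy X"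
  proof (rule metric_CauchyI)
    fix e :: real assume e: "0 < e"
    obtain N where N: "8 / e\<^sup>2 < real N" using reals_Archimedean2 by blast
    have "dist (X p) (X q) < e" if "p \<ge> N" "q \<ge> N" for p q
    proof -
      have s: "J (X k) < m + e\<^sup>2 / 8" if "k \<ge> N" for k
      proof -
        have "8 / e\<^sup>2 < real (Suc k)" using N that by linarith
        then have "1 / real (Suc k) < e\<^sup>2 / 8"
          using e by (simp add: field_simps del: of_nat_Suc)
        then show ?thesis using X[of k] by linarith
      qed
      have "4 * (J (X p) + J (X q) - 2 * m) < 4 * ((m + e\<^sup>2 / 8) + (m + e\<^sup>2 / 8) - 2 * m)"
        by (intro mult_strict_left_mono diff_strict_right_mono add_strict_mono s that) simp
      also have "\<dots> = e\<^sup>2" by simp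
      finally have "(norm (X p - X q))\<^sup>2 < e\<^sup>2" by (rule le_less_trans[OF par])
      then show ?thesis using e by (simp add: dist_norm power2_less_imp_less)
    qed
    then show "\<exists>M. \<forall>p\<ge>M. \<forall>q\<ge>M. dist (X p) (X q) < e" by blast
  qed
  then obtain z where z: "X \<longlonglongrightarrow> z" using Cauchy_convergent_iff convergent_def by blast
  have "(\<lambda>n. J (X n)) \<longlonglongrightarrow> J z"
    unfolding J_def by (intro tendsto_intros f.tendsto z) simp
  moreover have "(\<lambda>n. m + 1 / real (Suc n)) \<longlonglongrightarrow> m + 0"
    by (intro tendsto_intros LIMSEQ_Suc[OF lim_1_over_n])
  ultimately have "J z \<le> m + 0"
    by (rule LIMSEQ_le) (intro exI allI impI less_imp_le X)
  then have Jz: "J z \<le> J y" for y using mle[of y] by simp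
  have "f x = inner x z" for x
  proof -
    define d where "d = inner x z - f x"
    have q: "0 \<le> t * d + t\<^sup>2 * (norm x)\<^sup>2 / 2" for t
    proof -
      have "J (z + t *\<^sub>R x) = J z + t * d + t\<^sup>2 * (norm x)\<^sup>2 / 2"
        unfolding J_def d_def power2_norm_eq_inner
        by (simp add: f.add f.scaleR inner_add inner_commute power2_eq_square field_simps)
      then show ?thesis using Jz[of "z + t *\<^sub>R x"] by simp
    qed
    have "d = 0"
    proof (cases "x = 0")
      case True
      then show ?thesis by (simp add: d_def)
    next
      case False
      then have "(norm x)\<^sup>2 > 0" by simp
      then have "(- d / (norm x)\<^sup>2) * d + (- d / (norm x)\<^sup>2)\<^sup>2 * (norm x)\<^sup>2 / 2
          = - (d\<^sup>2 / (2 * (norm x)\<^sup>2))"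
        by (simp add: field_simps power2_eq_square)
      then have "d\<^sup>2 / (2 * (norm x)\<^sup>2) \<le> 0" using q[of "- d / (norm x)\<^sup>2"] by linarith
      then show ?thesis using \<open>(norm x)\<^sup>2 > 0\<close> by (simp add: divide_le_0_iff)
    qed
    then show ?thesis by (simp add: d_def)
  qed
  then show ?thesis by blast
qed

lemma cadjoint:
  fixes T :: "'a::chilbert_space \<Rightarrow> 'a"
  assumes T: "bounded_clinear T"
  shows "cinner (T x) y = cinner x (cadjoint T y)"
proof -
  have lin: "bounded_linear T" and TC: "\<And>c x. T (c *\<^sub>C x) = c *\<^sub>C T x"
    using T by (auto simp: bounded_clinear_def)
  have "\<exists>z. \<forall>x. inner (T x) y = inner x z" for y
    using real_riesz_representation[OF bounded_linear_compose[OF bounded_linear_inner_left lin]] .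
  then have "\<exists>S. \<forall>y x. inner (T x) y = inner x (S y)" by (rule choice[OF allI])
  then obtain S where S: "\<And>x y. inner (T x) y = inner x (S y)" by blast
  have ex: "\<forall>x y. cinner (T x) y = cinner x (S y)"
    by (simp only: complex_eq_iff Re_cinner Im_cinner TC[symmetric] S simp_thms)
  have "\<exists>!S. \<forall>x y. cinner (T x) y = cinner x (S y)"
  proof (rule ex1I[where a = S])
    fix R assume R: "\<forall>x y. cinner (T x) y = cinner x (R y)"
    have "inner x (R y) = inner x (S y)" for x y
      using R ex by (simp flip: Re_cinner)
    then show "R = S" by (intro ext vector_eq_ldot[THEN iffD1]) blast
  qed (rule ex)
  from theI'[OF this] show ?thesis unfolding cadjoint_def by blast
qed


section \<open>The semi-Hilbertian structure induced by a positive operator\<close>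

definition positive_op :: "('a::complex_inner \<Rightarrow> 'a) \<Rightarrow> bool"
  where "positive_op A \<longleftrightarrow> bounded_clinear A \<and> (\<forall>x. cinner (A x) x \<in> \<real>\<^sub>\<ge>\<^sub>0)"

definition inner_A :: "('a::complex_inner \<Rightarrow> 'a) \<Rightarrow> 'a \<Rightarrow> 'a \<Rightarrow> complex"
  where "inner_A A x y = cinner (A x) y"

definition seminorm_A :: "('a::complex_inner \<Rightarrow> 'a) \<Rightarrow> 'a \<Rightarrow> real"
  where "seminorm_A A x = sqrt (Re (inner_A A x x))"

definition adjointable_A :: "('a::complex_inner \<Rightarrow> 'a) \<Rightarrow> ('a \<Rightarrow> 'a) set"
  where "adjointable_A A =
    {T. bounded_clinear T \<and> (\<exists>R. bounded_clinear R \<and> A \<circ> R = cadjoint T \<circ> A)}"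

text \<open>The suprema below are suprema of sets of nonnegative reals.  Inserting \<open>0\<close> changes nothing
  unless the set is empty, which for positive \<open>A\<close> happens exactly when \<open>A\<close> is the zero
  operator; it then implements the convention that the supremum of the empty set is \<open>0\<close>.
  For operators admitting an adjoint with respect to \<open>A\<close> both sets are bounded above.\<close>

definition opnorm_A :: "('a::complex_inner \<Rightarrow> 'a) \<Rightarrow> ('a \<Rightarrow> 'a) \<Rightarrow> real"
  where "opnorm_A A T =
    Sup (insert 0 {seminorm_A A (T x) / seminorm_A A x | x. x \<in> closure (range A) \<and> x \<noteq> 0})"

definition numradius_A :: "('a::complex_inner \<Rightarrow> 'a) \<Rightarrow> ('a \<Rightarrow> 'a) \<Rightarrow> real"
  where "numradius_A A T =
    Sup (insert 0 {cmod (inner_A A (T x) x) | x. seminorm_A A x = 1})"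

definition block_op ::
  "('a::complex_inner \<Rightarrow> 'a) \<Rightarrow> ('a \<Rightarrow> 'a) \<Rightarrow> ('a \<Rightarrow> 'a) \<Rightarrow> ('a \<Rightarrow> 'a) \<Rightarrow> 'a \<times> 'a \<Rightarrow> 'a \<times> 'a"
  where "block_op T11 T12 T21 T22 = (\<lambda>(x, y). (T11 x + T12 y, T21 x + T22 y))"

end

theory Submission
  imports Defs
begin

text \<open>Let \<open>(x, y)\<close> have \<open>B\<close>-seminorm one, and let \<open>p\<close>, \<open>q\<close> be the \<open>A\<close>-seminorms of \<open>x\<close>, \<open>y\<close>, so that
  \<open>p\<^sup>2 + q\<^sup>2 = 1\<close>.  The quadratic form of the block operator is at most
  \<open>w(T11) p\<^sup>2 + (\<parallel>T12\<parallel> + \<parallel>T21\<parallel>) p q + w(T22) q\<^sup>2\<close>.  Writing \<open>p\<^sup>2 = 1/2 + (p\<^sup>2 - q\<^sup>2)/2\<close> and splitting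
  \<open>w(T11) (p\<^sup>2 - q\<^sup>2)\<close> in the ratio \<open>t : 1 - t\<close>, the Cauchy-Schwarz inequality against the unit vector
  \<open>(p\<^sup>2 - q\<^sup>2, 2 p q)\<close> gives the two square roots.

  The work lies in the form bound itself.  An operator with an \<open>A\<close>-adjoint \<open>R\<close> is bounded for the
  seminorm because \<open>R T\<close> is \<open>A\<close>-symmetric, and the supremum over the closed range of \<open>A\<close> in the
  operator seminorm controls all vectors because the range is dense for the seminorm.\<close>

section \<open>Real inequalities\<close>

text \<open>The discriminant argument: \<open>m\<close> plays the squared modulus of an inner
  product. For \<open>b > 0\<close> the minimiser \<open>s = 1 / b\<close> gives the claim; for
  \<open>b = 0\<close> the expression is affine in \<open>s\<close>.\<close>

lemma cauchy_schwarz_of_quadratic: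
  fixes a b m :: real
  assumes q: "\<And>s. 0 \<le> a - 2 * s * m + s\<^sup>2 * m * b" and "0 \<le> a" "0 \<le> b" "0 \<le> m"
  shows "m \<le> a * b"
proof (cases "b = 0")
  case True
  show ?thesis
  proof (rule ccontr)
    assume "\<not> m \<le> a * b"
    then have "m > 0" using True by simp
    \<comment> \<open>At this \<open>s\<close> the expression equals \<open>-1\<close>.\<close>
    then show False using q[of "(a + 1) / (2 * m)"] True by (simp add: field_simps)
  qed
next
  case False
  then have "b > 0" using \<open>0 \<le> b\<close> by simp
  then show ?thesis using q[of "1 / b"] by (simp add: field_simps power2_eq_square)
qed

text \<open>Log-convexity makes successive ratios nondecreasing. A first ratio above
  \<open>K\<close> would force growth at least like \<open>K ^ k\<close>, which beats
  \<open>C * L ^ k\<close> because \<open>L < K\<close>.\<close>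

lemma log_convex_growth_bound:
  fixes g :: "nat \<Rightarrow> real"
  assumes nonneg: "\<And>k. 0 \<le> g k"
    and convex: "\<And>k. (g (Suc k))\<^sup>2 \<le> g k * g (Suc (Suc k))"
    and growth: "\<And>k. g k \<le> C * L ^ k" and "0 \<le> L" "L < K"
  shows "g 1 \<le> K * g 0"
proof (rule ccontr)
  assume neg: "\<not> g 1 \<le> K * g 0"
  have K: "K > 0" using assms by linarith
  have "K * g 0 \<ge> 0" using K nonneg[of 0] by simp
  then have g1: "g 1 > 0" using neg by linarith
  \<comment> \<open>The second conjunct keeps \<open>g (Suc k)\<close> positive, so that it can be
    cancelled when the ratio bound is carried on.\<close>
  have step: "K * g k \<le> g (Suc k) \<and> K ^ k * g 1 \<le> g (Suc k)" for k
  proof (induction k)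
    case 0
    then show ?case using neg by simp
  next
    case (Suc k)
    have "0 < K ^ k * g 1" using K g1 by simp
    then have pos: "g (Suc k) > 0" using Suc by linarith
    have "K * (g (Suc k))\<^sup>2 \<le> K * g k * g (Suc (Suc k))"
      using convex[of k] K by (simp add: mult.assoc)
    also have "\<dots> \<le> g (Suc k) * g (Suc (Suc k))"
      using Suc nonneg by (intro mult_right_mono) auto
    finally have "g (Suc k) * (K * g (Suc k)) \<le> g (Suc k) * g (Suc (Suc k))"
      by (simp add: power2_eq_square mult_ac)
    then have 1: "K * g (Suc k) \<le> g (Suc (Suc k))" using pos by simp
    have "K ^ Suc k * g 1 \<le> K * g (Suc k)" using Suc K by (simp add: mult.assoc)
    with 1 show ?case by linarith
  qed
  have "g 1 \<le> C * L * (L / K) ^ k" for k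
  proof -
    have "K ^ k * g 1 \<le> C * L ^ Suc k" using step growth order_trans by blast
    then show ?thesis using K by (simp add: field_simps power_divide)
  qed
  moreover have "(\<lambda>k. C * L * (L / K) ^ k) \<longlonglongrightarrow> C * L * 0"
    using \<open>0 \<le> L\<close> \<open>L < K\<close> by (intro tendsto_mult tendsto_const LIMSEQ_realpow_zero) auto
  ultimately have "g 1 \<le> C * L * 0"
    by (intro LIMSEQ_le[OF tendsto_const]) auto
  then show False using g1 by simp
qed

lemma bounded_clinear_compose:
  "bounded_clinear S \<Longrightarrow> bounded_clinear T \<Longrightarrow> bounded_clinear (S \<circ> T)"
  using bounded_linear_compose[of S T] by (simp add: bounded_clinear_def comp_def)

lemma bounded_clinear_iterate_bound:
  fixes S :: "'a::complex_inner \<Rightarrow> 'a"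
  assumes "bounded_clinear S"
  obtains L where "0 \<le> L" "\<And>k x. norm ((S ^^ k) x) \<le> L ^ k * norm x"
proof -
  have "bounded_linear S" using assms by (simp add: bounded_clinear_def)
  then obtain L where L: "0 \<le> L" "\<And>x. norm (S x) \<le> norm x * L"
    using bounded_linear.nonneg_bounded by blast
  have "norm ((S ^^ k) x) \<le> L ^ k * norm x" for k x
  proof (induction k)
    case (Suc k)
    have "norm ((S ^^ Suc k) x) \<le> norm ((S ^^ k) x) * L" using L(2)[of "(S ^^ k) x"] by simp
    also have "\<dots> \<le> L ^ k * norm x * L" by (intro mult_right_mono Suc.IH L(1))
    finally show ?case by (simp add: mult_ac)
  qed simp
  with L(1) that show thesis by blast
qed

section \<open>The semi-inner product of a positive operator\<close>

context
  fixes A :: "'h::chilbert_space \<Rightarrow> 'h"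
  assumes A: "positive_op A"
begin

lemma A_add: "A (x + y) = A x + A y"
  and A_scaleC: "A (c *\<^sub>C x) = c *\<^sub>C A x"
  and A_bounded_linear: "bounded_linear A"
  using A by (auto simp: positive_op_def bounded_clinear_def bounded_linear.linear linear_add)

lemma inner_A_add_left: "inner_A A (x + y) z = inner_A A x z + inner_A A y z"
  and inner_A_add_right: "inner_A A x (y + z) = inner_A A x y + inner_A A x z"
  and inner_A_scaleC_left: "inner_A A (c *\<^sub>C x) y = c * inner_A A x y"
  and inner_A_scaleC_right: "inner_A A x (c *\<^sub>C y) = cnj c * inner_A A x y"
  by (simp_all add: inner_A_def A_add A_scaleC cinner_add_left cinner_add_right
      cinner_scaleC_left cinner_scaleC_right)

lemma inner_A_self_nonneg: "inner_A A x x \<in> \<real>\<^sub>\<ge>\<^sub>0"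
  using A by (simp add: positive_op_def inner_A_def)

lemma inner_A_self: "inner_A A x x = complex_of_real ((seminorm_A A x)\<^sup>2)"
  using inner_A_self_nonneg[of x]
  by (auto simp: seminorm_A_def complex_nonneg_Reals_iff complex_eq_iff)

lemma seminorm_A_nonneg: "0 \<le> seminorm_A A x"
  using inner_A_self_nonneg[of x] by (simp add: seminorm_A_def complex_nonneg_Reals_iff)

text \<open>Polarization: the quadratic form is real, and its values at \<open>x + y\<close> and
  \<open>x + i y\<close> settle the imaginary and the real part.\<close>

lemma inner_A_commute: "inner_A A y x = cnj (inner_A A x y)"
proof -
  have im: "Im (inner_A A u u) = 0" for u by (simp add: inner_A_self)
  have "Im (inner_A A y x) = - Im (inner_A A x y)"
    using im[of "x + y"] im[of x] im[of y] by (simp add: inner_A_add_left inner_A_add_right)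
  moreover have "Re (inner_A A y x) = Re (inner_A A x y)"
    using im[of "x + \<i> *\<^sub>C y"] im[of x] im[of y]
    by (simp add: inner_A_add_left inner_A_add_right inner_A_scaleC_left inner_A_scaleC_right)
  ultimately show ?thesis by (simp add: complex_eq_iff)
qed

lemma inner_A_symmetric: "cinner x (A y) = inner_A A x y"
  using inner_A_commute[of x y] cinner_commute[of x "A y"] by (simp add: inner_A_def)

lemma inner_A_cauchy_schwarz: "cmod (inner_A A x y) \<le> seminorm_A A x * seminorm_A A y"
proof -
  define h where "h = inner_A A x y"
  have "(cmod h)\<^sup>2 \<le> (seminorm_A A x)\<^sup>2 * (seminorm_A A y)\<^sup>2"
  proof (rule cauchy_schwarz_of_quadratic)
    fix s :: real
    \<comment> \<open>The factor \<open>h\<close> aligns the phases: both cross terms become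
      \<open>-s\<close> times the squared modulus of \<open>h\<close>.\<close>
    define c where "c = - (of_real s * h)"
    have "0 \<le> Re (inner_A A (x + c *\<^sub>C y) (x + c *\<^sub>C y))"
      by (simp add: inner_A_self)
    also have "inner_A A (x + c *\<^sub>C y) (x + c *\<^sub>C y)
        = inner_A A x x + cnj c * h + c * cnj h + c * cnj c * inner_A A y y"
      by (simp add: inner_A_add_left inner_A_add_right inner_A_scaleC_left inner_A_scaleC_right
          h_def inner_A_commute[of y x] algebra_simps)
    also have "Re \<dots> = (seminorm_A A x)\<^sup>2 - 2 * s * (cmod h)\<^sup>2
        + s\<^sup>2 * (cmod h)\<^sup>2 * (seminorm_A A y)\<^sup>2"
      unfolding inner_A_self c_def cmod_power2 by (simp add: power2_eq_square algebra_simps)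
    finally show "0 \<le> \<dots>" .
  qed simp_all
  then have "(cmod h)\<^sup>2 \<le> (seminorm_A A x * seminorm_A A y)\<^sup>2"
    by (simp add: power_mult_distrib)
  then show ?thesis
    unfolding h_def by (rule power2_le_imp_le) (simp add: seminorm_A_nonneg)
qed

lemma seminorm_A_triangle: "seminorm_A A (x + y) \<le> seminorm_A A x + seminorm_A A y"
proof (rule power2_le_imp_le)
  have "(seminorm_A A (x + y))\<^sup>2 = Re (inner_A A (x + y) (x + y))"
    by (simp add: inner_A_self)
  also have "\<dots> = (seminorm_A A x)\<^sup>2 + 2 * Re (inner_A A x y) + (seminorm_A A y)\<^sup>2"
  proof -
    have "Re (inner_A A y x) = Re (inner_A A x y)" by (subst inner_A_commute) simp
    then show ?thesis
      unfolding inner_A_add_left inner_A_add_right by (simp add: inner_A_self del: of_real_power)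
  qed
  also have "\<dots> \<le> (seminorm_A A x + seminorm_A A y)\<^sup>2"
    using inner_A_cauchy_schwarz[of x y] complex_Re_le_cmod[of "inner_A A x y"]
    by (simp add: power2_sum)
  finally show "(seminorm_A A (x + y))\<^sup>2 \<le> (seminorm_A A x + seminorm_A A y)\<^sup>2" .
qed (simp add: seminorm_A_nonneg)

lemma seminorm_A_scaleC: "seminorm_A A (c *\<^sub>C x) = cmod c * seminorm_A A x"
proof -
  have "complex_of_real ((seminorm_A A (c *\<^sub>C x))\<^sup>2) = c * cnj c * inner_A A x x"
    unfolding inner_A_self[symmetric] by (simp add: inner_A_scaleC_left inner_A_scaleC_right)
  also have "\<dots> = complex_of_real ((cmod c * seminorm_A A x)\<^sup>2)"
    by (simp only: inner_A_self power_mult_distrib of_real_mult complex_norm_square)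
  finally have "(seminorm_A A (c *\<^sub>C x))\<^sup>2 = (cmod c * seminorm_A A x)\<^sup>2"
    unfolding of_real_eq_iff .
  then show ?thesis by (simp add: power2_eq_iff_nonneg seminorm_A_nonneg)
qed

section \<open>Comparison of norm and seminorm\<close>

lemma seminorm_A_bound:
  obtains C where "0 \<le> C" "\<And>x. seminorm_A A x \<le> C * norm x"
proof -
  obtain K where K: "0 \<le> K" "\<And>x. norm (A x) \<le> norm x * K"
    using bounded_linear.nonneg_bounded[OF A_bounded_linear] by blast
  have "seminorm_A A x \<le> sqrt K * norm x" for x
  proof -
    have "Re (inner_A A x x) \<le> norm (A x) * norm x"
      using norm_cauchy_schwarz[of "A x" x] by (simp add: inner_A_def Re_cinner)
    also have "\<dots> \<le> norm x * K * norm x" by (intro mult_right_mono K) simp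
    finally have "sqrt (Re (inner_A A x x)) \<le> sqrt (K * (norm x)\<^sup>2)"
      by (simp add: power2_eq_square mult_ac)
    then show ?thesis by (simp add: seminorm_A_def real_sqrt_mult)
  qed
  with K(1) that[of "sqrt K"] show thesis by simp
qed

text \<open>The squared norm of \<open>A x\<close> is the semi-inner product of \<open>x\<close>
  with \<open>A x\<close>; Cauchy-Schwarz leaves one factor \<open>norm (A x)\<close> to
  cancel.\<close>

lemma norm_A_le_seminorm_A:
  obtains K where "0 < K" "\<And>x. (norm (A x))\<^sup>2 \<le> K * (seminorm_A A x)\<^sup>2"
proof -
  obtain C where C: "0 \<le> C" "\<And>x. seminorm_A A x \<le> C * norm x"
    using seminorm_A_bound by blast
  \<comment> \<open>Adding \<open>1\<close> keeps the constant positive even if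
    \<open>C = 0\<close>, so its reciprocal can serve as a step size.\<close>
  have "(norm (A x))\<^sup>2 \<le> (C\<^sup>2 + 1) * (seminorm_A A x)\<^sup>2" for x
  proof -
    have "(norm (A x))\<^sup>2 = cmod (inner_A A x (A x))"
      by (simp add: inner_A_def cinner_self norm_power)
    also have "\<dots> \<le> seminorm_A A x * (C * norm (A x))"
      using inner_A_cauchy_schwarz[of x "A x"] C(2)[of "A x"] seminorm_A_nonneg
      by (meson mult_left_mono order_trans)
    finally have "norm (A x) * norm (A x) \<le> norm (A x) * (C * seminorm_A A x)"
      by (simp add: power2_eq_square mult_ac)
    then have "norm (A x) \<le> C * seminorm_A A x"
      using C(1) seminorm_A_nonneg[of x] by (cases "norm (A x) = 0") auto
    then have "(norm (A x))\<^sup>2 \<le> (C * seminorm_A A x)\<^sup>2" by (intro power_mono) auto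
    also have "\<dots> \<le> (C\<^sup>2 + 1) * (seminorm_A A x)\<^sup>2"
      by (simp add: power_mult_distrib distrib_right)
    finally show ?thesis .
  qed
  moreover have "0 < C\<^sup>2 + 1" by (simp add: add_nonneg_pos)
  ultimately show thesis using that by blast
qed

text \<open>Lax's argument: the seminorms of the iterates \<open>S\<^sup>k x\<close> form a log-convex sequence of at most
  geometric growth.\<close>

lemma seminorm_A_symmetric_op_bound:
  assumes S: "bounded_clinear S"
    and sym: "\<And>x y. inner_A A (S x) y = inner_A A x (S y)"
  obtains K where "0 \<le> K" "\<And>x. seminorm_A A (S x) \<le> K * seminorm_A A x"
proof -
  obtain L where L: "0 \<le> L" "\<And>k x. norm ((S ^^ k) x) \<le> L ^ k * norm x"
    using bounded_clinear_iterate_bound[OF S] by blast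
  obtain C where C: "0 \<le> C" "\<And>x. seminorm_A A x \<le> C * norm x"
    using seminorm_A_bound by blast
  \<comment> \<open>\<open>L + 1\<close> supplies the strict gap above the growth rate
    \<open>L\<close>.\<close>
  have "seminorm_A A (S x) \<le> (L + 1) * seminorm_A A x" for x
  proof -
    define g where "g k = seminorm_A A ((S ^^ k) x)" for k
    have "g 1 \<le> (L + 1) * g 0"
    proof (rule log_convex_growth_bound)
      show "0 \<le> g k" for k by (simp add: g_def seminorm_A_nonneg)
      show "(g (Suc k))\<^sup>2 \<le> g k * g (Suc (Suc k))" for k
      proof -
        let ?y = "(S ^^ k) x"
        have "(g (Suc k))\<^sup>2 = cmod (inner_A A (S ?y) (S ?y))"
          by (simp add: g_def inner_A_self norm_power)
        also have "\<dots> = cmod (inner_A A ?y (S (S ?y)))" by (simp add: sym)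
        finally show ?thesis using inner_A_cauchy_schwarz[of ?y "S (S ?y)"] by (simp add: g_def)
      qed
      show "g k \<le> C * norm x * L ^ k" for k
      proof -
        have "g k \<le> C * norm ((S ^^ k) x)" unfolding g_def by (rule C)
        also have "\<dots> \<le> C * (L ^ k * norm x)" by (intro mult_left_mono L C)
        finally show ?thesis by (simp add: mult_ac)
      qed
    qed (use L in auto)
    then show ?thesis by (simp add: g_def)
  qed
  then show thesis using that[of "L + 1"] L(1) by simp
qed

text \<open>The iterates of \<open>I - cA\<close> on \<open>y\<close> differ from \<open>y\<close> by elements of the range of \<open>A\<close>, and for
  small \<open>c\<close> each step lowers the squared norm by at least \<open>c\<close> times the squared seminorm; hence the
  seminorm becomes arbitrarily small.  This replaces the projection onto the closure of the range.\<close>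

lemma range_A_seminorm_dense:
  assumes "0 < e"
  obtains z where "seminorm_A A (y - A z) < e"
proof (rule ccontr)
  assume neg: "\<not> thesis"
  obtain K where K: "0 < K" "\<And>x. (norm (A x))\<^sup>2 \<le> K * (seminorm_A A x)\<^sup>2"
    using norm_A_le_seminorm_A by blast
  \<comment> \<open>With this step size the second-order term uses up at most half of the
    first-order decrease \<open>2 * c\<close> times the squared seminorm.\<close>
  define c where "c = 1 / K"
  define u where "u z = y - A z" for z
  have c: "c > 0" using K(1) by (simp add: c_def)
  have descent: "(norm (u z - c *\<^sub>R A (u z)))\<^sup>2 \<le> (norm (u z))\<^sup>2 - c * e\<^sup>2" for z
  proof -
    let ?u = "u z"
    have "(norm (?u - c *\<^sub>R A ?u))\<^sup>2
        = (norm ?u)\<^sup>2 - 2 * c * inner (A ?u) ?u + c\<^sup>2 * (norm (A ?u))\<^sup>2"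
      unfolding power2_norm_eq_inner
      by (simp add: inner_diff inner_commute power2_eq_square[of c] algebra_simps)
    also have "inner (A ?u) ?u = (seminorm_A A ?u)\<^sup>2"
      using inner_A_self[of ?u] by (simp add: inner_A_def flip: Re_cinner)
    also have "c\<^sup>2 * (norm (A ?u))\<^sup>2 \<le> c * (seminorm_A A ?u)\<^sup>2"
      using mult_left_mono[OF K(2)[of ?u], of "c\<^sup>2"] K(1)
      by (simp add: c_def power2_eq_square field_simps)
    finally have "(norm (?u - c *\<^sub>R A ?u))\<^sup>2 \<le> (norm ?u)\<^sup>2 - c * (seminorm_A A ?u)\<^sup>2"
      by simp
    moreover have "e \<le> seminorm_A A ?u" using neg that[of z] unfolding u_def by (meson not_less)
    then have "e\<^sup>2 \<le> (seminorm_A A ?u)\<^sup>2" using \<open>0 < e\<close> by (intro power_mono) auto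
    ultimately show ?thesis using c by (smt (verit) mult_left_mono)
  qed
  have "\<exists>z. (norm (u z))\<^sup>2 \<le> (norm y)\<^sup>2 - real n * (c * e\<^sup>2)" for n
  proof (induction n)
    case 0
    have "u 0 = y"
      using A_bounded_linear by (simp add: u_def bounded_linear.linear linear_0)
    then show ?case by (auto intro: exI[of _ 0])
  next
    case (Suc n)
    then obtain z where z: "(norm (u z))\<^sup>2 \<le> (norm y)\<^sup>2 - real n * (c * e\<^sup>2)" by blast
    \<comment> \<open>The descent step preserves the form \<open>y - A z\<close>, so it can be
      iterated.\<close>
    have "u (z + c *\<^sub>R u z) = u z - c *\<^sub>R A (u z)"
      unfolding u_def using A_bounded_linear
      by (simp add: A_add bounded_linear.linear linear_scale)
    then have "(norm (u (z + c *\<^sub>R u z)))\<^sup>2 \<le> (norm (u z))\<^sup>2 - c * e\<^sup>2"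
      using descent by simp
    then have "(norm (u (z + c *\<^sub>R u z)))\<^sup>2 \<le> (norm y)\<^sup>2 - real (Suc n) * (c * e\<^sup>2)"
      using z by (simp add: algebra_simps)
    then show ?case by blast
  qed
  moreover obtain n where "(norm y)\<^sup>2 < real n * (c * e\<^sup>2)"
    using reals_Archimedean3[of "c * e\<^sup>2"] c \<open>0 < e\<close> by auto
  ultimately show False by (smt (verit) zero_le_power2)
qed

section \<open>Operators with an adjoint for the semi-inner product\<close>

context
  fixes T assumes T: "T \<in> adjointable_A A"
begin

lemma adjointable_bounded_clinear: "bounded_clinear T"
  using T by (simp add: adjointable_A_def)

lemma adjointable_add: "T (x + y) = T x + T y"
  using adjointable_bounded_clinear
  by (simp add: bounded_clinear_def bounded_linear.linear linear_add)

text \<open>The squared seminorm of \<open>T x\<close> is the semi-inner product of \<open>x\<close>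
  with \<open>R (T x)\<close>, so a bound for the symmetric operator \<open>R T\<close> gives one
  for \<open>T\<close>. This makes both suprema range over bounded sets.\<close>

lemma adjointable_seminorm_bound:
  obtains M where "0 \<le> M" "\<And>x. seminorm_A A (T x) \<le> M * seminorm_A A x"
proof -
  obtain R where R: "bounded_clinear R" "A \<circ> R = cadjoint T \<circ> A"
    using T by (auto simp: adjointable_A_def)
  have adj: "inner_A A x (R y) = inner_A A (T x) y" for x y
  proof -
    have "inner_A A x (R y) = cinner x (cadjoint T (A y))"
      using fun_cong[OF R(2), of y] by (simp flip: inner_A_symmetric)
    also have "\<dots> = inner_A A (T x) y"
      by (simp flip: cadjoint[OF adjointable_bounded_clinear] inner_A_symmetric)
    finally show ?thesis .
  qed
  have adj': "inner_A A (R y) x = inner_A A y (T x)" for x y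
    using adj[of x y] inner_A_commute by metis
  obtain K where K: "0 \<le> K" "\<And>x. seminorm_A A (R (T x)) \<le> K * seminorm_A A x"
    using seminorm_A_symmetric_op_bound[of "R \<circ> T"]
      bounded_clinear_compose[OF R(1) adjointable_bounded_clinear]
    by (auto simp: adj adj')
  have "seminorm_A A (T x) \<le> sqrt K * seminorm_A A x" for x
  proof (rule power2_le_imp_le)
    have "(seminorm_A A (T x))\<^sup>2 = cmod (inner_A A (T x) (T x))"
      by (simp add: inner_A_self norm_power)
    also have "\<dots> = cmod (inner_A A x (R (T x)))" by (simp add: adj)
    also have "\<dots> \<le> seminorm_A A x * (K * seminorm_A A x)"
      using inner_A_cauchy_schwarz[of x "R (T x)"] K(2)[of x] seminorm_A_nonneg
      by (meson mult_left_mono order_trans)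
    also have "\<dots> = (sqrt K * seminorm_A A x)\<^sup>2"
      using K(1) by (simp add: power_mult_distrib power2_eq_square[of "seminorm_A A x"])
    finally show "(seminorm_A A (T x))\<^sup>2 \<le> (sqrt K * seminorm_A A x)\<^sup>2" .
  qed (simp add: K seminorm_A_nonneg)
  with K(1) that[of "sqrt K"] show thesis by simp
qed

lemma numradius_A_nonneg: "0 \<le> numradius_A A T"
  and numradius_A_bound: "cmod (inner_A A (T x) x) \<le> numradius_A A T * (seminorm_A A x)\<^sup>2"
proof -
  obtain M where M: "0 \<le> M" "\<And>x. seminorm_A A (T x) \<le> M * seminorm_A A x"
    using adjointable_seminorm_bound by blast
  have le: "cmod (inner_A A (T x) x) \<le> M * (seminorm_A A x)\<^sup>2" for x
    using inner_A_cauchy_schwarz[of "T x" x] mult_right_mono[OF M(2), of "seminorm_A A x" x]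
      seminorm_A_nonneg[of x] by (simp add: power2_eq_square mult_ac)
  let ?W = "insert 0 {cmod (inner_A A (T x) x) | x. seminorm_A A x = 1}"
  have bdd: "bdd_above ?W"
    by (rule bdd_aboveI[of _ M]) (use M(1) le in \<open>auto, metis mult.right_neutral one_power2\<close>)
  show "0 \<le> numradius_A A T"
    unfolding numradius_A_def by (rule cSup_upper[OF _ bdd]) simp
  show "cmod (inner_A A (T x) x) \<le> numradius_A A T * (seminorm_A A x)\<^sup>2"
  \<comment> \<open>A vector of seminorm zero cannot be normalised, but there the form vanishes by
    \<open>le\<close>.\<close>
  proof (cases "seminorm_A A x = 0")
    case True
    then show ?thesis using le[of x] by simp
  next
    case False
    let ?n = "seminorm_A A x"
    define c where "c = complex_of_real (1 / ?n)"
    have n: "?n > 0" using False seminorm_A_nonneg[of x] by simp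
    have "seminorm_A A (c *\<^sub>C x) = 1" using n by (simp add: seminorm_A_scaleC c_def norm_divide)
    then have "cmod (inner_A A (T (c *\<^sub>C x)) (c *\<^sub>C x)) \<le> numradius_A A T"
      unfolding numradius_A_def by (intro cSup_upper[OF _ bdd]) auto
    moreover have "T (c *\<^sub>C x) = c *\<^sub>C T x"
      using adjointable_bounded_clinear by (simp add: bounded_clinear_def)
    ultimately have "cmod (inner_A A (T x) x) / ?n\<^sup>2 \<le> numradius_A A T"
      using n by (simp add: inner_A_scaleC_left inner_A_scaleC_right norm_mult norm_divide c_def
          power2_eq_square)
    then show ?thesis using n by (simp add: field_simps)
  qed
qed

lemma seminorm_A_le_opnorm_A: "seminorm_A A (T y) \<le> opnorm_A A T * seminorm_A A y"
proof -
  obtain M where M: "0 \<le> M" "\<And>x. seminorm_A A (T x) \<le> M * seminorm_A A x"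
    using adjointable_seminorm_bound by blast
  let ?N = "opnorm_A A T"
  let ?W = "insert 0 {seminorm_A A (T x) / seminorm_A A x | x. x \<in> closure (range A) \<and> x \<noteq> 0}"
  \<comment> \<open>Where the seminorm vanishes, the quotient is \<open>0\<close> by the convention
    for division.\<close>
  have ratio: "seminorm_A A (T x) / seminorm_A A x \<le> M" for x
    using M seminorm_A_nonneg[of x] by (cases "seminorm_A A x = 0") (auto simp: divide_simps)
  have bdd: "bdd_above ?W"
    by (rule bdd_aboveI[of _ M]) (use M(1) ratio in auto)
  have N: "0 \<le> ?N"
    unfolding opnorm_A_def by (rule cSup_upper[OF _ bdd]) simp
  have range: "seminorm_A A (T (A z)) \<le> ?N * seminorm_A A (A z)" for z
  proof (cases "seminorm_A A (A z) = 0")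
    case True
    then show ?thesis using M(2)[of "A z"] by simp
  next
    case False
    then have "A z \<noteq> 0"
      using M(2)[of 0] seminorm_A_scaleC[of 0 0] scaleR_scaleC[of 0 "0::'h"] by auto
    then have "seminorm_A A (T (A z)) / seminorm_A A (A z) \<le> ?N"
      unfolding opnorm_A_def
      by (intro cSup_upper[OF _ bdd]) (auto intro: closure_subset[THEN subsetD])
    then show ?thesis
      using False seminorm_A_nonneg[of "A z"] by (simp add: divide_simps split: if_splits)
  qed
  show "seminorm_A A (T y) \<le> ?N * seminorm_A A y"
  proof (rule field_le_epsilon)
    fix e :: real assume "0 < e"
    \<comment> \<open>An error below \<open>d\<close> costs at most \<open>?N * d\<close> through
      \<open>A z\<close> and \<open>M * d\<close> through \<open>T\<close>; the \<open>1\<close>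
      keeps the denominator positive.\<close>
    define d where "d = e / (?N + M + 1)"
    have d: "0 < d" using \<open>0 < e\<close> M(1) N by (simp add: d_def)
    then obtain z where z: "seminorm_A A (y - A z) < d" using range_A_seminorm_dense by blast
    let ?u = "y - A z"
    have neg: "(-1) *\<^sub>C ?u = A z - y" using scaleR_scaleC[of "-1" ?u] by simp
    have "seminorm_A A (T y) \<le> seminorm_A A (T (A z)) + seminorm_A A (T ?u)"
      using seminorm_A_triangle[of "T (A z)" "T ?u"] adjointable_add[of "A z" ?u] by simp
    also have "\<dots> \<le> ?N * seminorm_A A (A z) + M * seminorm_A A ?u"
      by (intro add_mono range M)
    also have "seminorm_A A (A z) \<le> seminorm_A A y + seminorm_A A ?u"
      using seminorm_A_triangle[of y "A z - y"] seminorm_A_scaleC[of "-1" ?u]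
      by (simp add: neg)
    finally have "seminorm_A A (T y)
        \<le> ?N * (seminorm_A A y + seminorm_A A ?u) + M * seminorm_A A ?u"
      using N by (simp add: mult_left_mono)
    also have "\<dots> = ?N * seminorm_A A y + (?N + M) * seminorm_A A ?u" by (simp add: algebra_simps)
    also have "(?N + M) * seminorm_A A ?u \<le> (?N + M) * d"
      using z N M(1) by (intro mult_left_mono) auto
    also have "(?N + M) * d \<le> (?N + M + 1) * d" using d by (intro mult_right_mono) auto
    also have "(?N + M + 1) * d = e" using N M(1) by (simp add: d_def)
    finally show "seminorm_A A (T y) \<le> ?N * seminorm_A A y + e" by simp
  qed
qed

lemma inner_A_le_opnorm_A:
  "cmod (inner_A A (T y) x) \<le> opnorm_A A T * seminorm_A A y * seminorm_A A x"
  using inner_A_cauchy_schwarz[of "T y" x]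
    mult_right_mono[OF seminorm_A_le_opnorm_A seminorm_A_nonneg] order_trans by blast

end

end

text \<open>With \<open>p = cos (\<theta>/2)\<close> and \<open>q = sin (\<theta>/2)\<close>, this bounds \<open>u cos \<theta> + v sin \<theta>\<close>.\<close>

lemma double_angle_cauchy_schwarz:
  fixes p q :: real
  assumes "p\<^sup>2 + q\<^sup>2 = 1"
  shows "u * (p\<^sup>2 - q\<^sup>2) + v * (2 * p * q) \<le> sqrt (u\<^sup>2 + v\<^sup>2)"
proof (rule real_le_rsqrt)
  define c s where "c = p\<^sup>2 - q\<^sup>2" and "s = 2 * p * q"
  have "c\<^sup>2 + s\<^sup>2 = (p\<^sup>2 + q\<^sup>2)\<^sup>2"
    by (simp add: c_def s_def power2_eq_square algebra_simps)
  then have cs: "c\<^sup>2 + s\<^sup>2 = 1" using assms by simp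
  \<comment> \<open>Lagrange's identity; dropping the second square leaves Cauchy-Schwarz.\<close>
  have "(u * c + v * s)\<^sup>2 + (u * s - v * c)\<^sup>2 = (u\<^sup>2 + v\<^sup>2) * (c\<^sup>2 + s\<^sup>2)"
    by (simp add: power2_eq_square algebra_simps)
  then show "(u * c + v * s)\<^sup>2 \<le> u\<^sup>2 + v\<^sup>2"
    by (metis cs le_add_same_cancel1 mult_1_right zero_le_power2)
qed

section \<open>The quadratic form of the block operator\<close>

theorem theorem5:
  fixes A T11 T12 T21 T22 :: "'h::chilbert_space \<Rightarrow> 'h"
    and B :: "'h \<times> 'h \<Rightarrow> 'h \<times> 'h"
    and t :: real
  assumes nontrivial: "\<exists>x::'h. x \<noteq> 0"
    and A: "positive_op A"
    and T: "T11 \<in> adjointable_A A" "T12 \<in> adjointable_A A"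
      "T21 \<in> adjointable_A A" "T22 \<in> adjointable_A A"
    and B: "B = block_op A (\<lambda>_. 0) (\<lambda>_. 0) A"
    and t: "0 \<le> t" "t \<le> 1"
  shows "numradius_A B (block_op T11 T12 T21 T22)
    \<le> 1/2 * numradius_A A T11 + numradius_A A T22
      + 1/2 * sqrt (t\<^sup>2 * (numradius_A A T11)\<^sup>2 + (opnorm_A A T12)\<^sup>2)
      + 1/2 * sqrt ((1 - t)\<^sup>2 * (numradius_A A T11)\<^sup>2 + (opnorm_A A T21)\<^sup>2)"
proof -
  let ?n = "seminorm_A A"
  let ?a = "numradius_A A T11" and ?d = "numradius_A A T22"
  let ?b = "opnorm_A A T12" and ?c = "opnorm_A A T21"
  let ?rhs = "1/2 * ?a + ?d + 1/2 * sqrt (t\<^sup>2 * ?a\<^sup>2 + ?b\<^sup>2) + 1/2 * sqrt ((1 - t)\<^sup>2 * ?a\<^sup>2 + ?c\<^sup>2)"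
  have a: "0 \<le> ?a" and d: "0 \<le> ?d" using numradius_A_nonneg[OF A] T by auto
  have "cmod (inner_A B (block_op T11 T12 T21 T22 z) z) \<le> ?rhs" if z: "seminorm_A B z = 1" for z
  proof -
    obtain x y where xy: "z = (x, y)" by fastforce
    define p q where "p = ?n x" and "q = ?n y"
    have "inner_A B z z = complex_of_real (p\<^sup>2 + q\<^sup>2)"
      using inner_A_self[OF A, of x] inner_A_self[OF A, of y]
      by (simp add: xy B block_op_def inner_A_def cinner_prod_def p_def q_def)
    then have pq: "p\<^sup>2 + q\<^sup>2 = 1" using z by (simp add: seminorm_A_def)
    have "inner_A B (block_op T11 T12 T21 T22 z) z
        = inner_A A (T11 x) x + inner_A A (T12 y) x + inner_A A (T21 x) y + inner_A A (T22 y) y"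
      using A_add[OF A]
      by (simp add: xy B block_op_def inner_A_def cinner_prod_def cinner_add_left)
    also have "cmod \<dots> \<le> ?a * p\<^sup>2 + ?b * q * p + ?c * p * q + ?d * q\<^sup>2"
      unfolding p_def q_def
      by (intro order_trans[OF norm_triangle_ineq] add_mono numradius_A_bound[OF A]
          inner_A_le_opnorm_A[OF A] T)
    \<comment> \<open>The form at \<open>T22\<close> is estimated crudely by
      \<open>q\<^sup>2 \<le> 1\<close>; this is why \<open>?d\<close> enters with coefficient
      one.\<close>
    also have "?d * q\<^sup>2 \<le> ?d"
      using d pq zero_le_power2[of p] by (intro mult_left_le) linarith+
    also have "?a * p\<^sup>2 = 1/2 * ?a + 1/2 * (?a * (p\<^sup>2 - q\<^sup>2))"
    proof -
      have q: "q\<^sup>2 = 1 - p\<^sup>2" using pq by simp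
      show ?thesis unfolding q by (simp add: field_simps)
    qed
    finally have "cmod (inner_A B (block_op T11 T12 T21 T22 z) z)
        \<le> 1/2 * ?a + ?d + 1/2 * (t * ?a * (p\<^sup>2 - q\<^sup>2) + ?b * (2 * p * q))
          + 1/2 * ((1 - t) * ?a * (p\<^sup>2 - q\<^sup>2) + ?c * (2 * p * q))"
      by (simp add: algebra_simps)
    also have "\<dots> \<le> ?rhs"
      using double_angle_cauchy_schwarz[OF pq, of "t * ?a" ?b]
        double_angle_cauchy_schwarz[OF pq, of "(1 - t) * ?a" ?c]
      unfolding power_mult_distrib by (intro add_mono mult_left_mono order_refl) simp_all
    finally show ?thesis .
  qed
  \<comment> \<open>The supremum also runs over the inserted \<open>0\<close>.\<close>
  moreover have "0 \<le> ?rhs" using a d by simp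
  ultimately show ?thesis
    unfolding numradius_A_def[of B] by (intro cSup_least) auto
qed

end
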